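(* Let $h:\mathbf{N}\to\mathbf{R}_{>0}$ be an increasing function tending to infinity. Then, for all $L>0$, there exist sequences $(q_n)_n$ and $(q_n')_n$ of square-free integers such that both $\rho(q_n)/\log q_n$ and $\rho(q_n')/\log q_n'$ tend to $\infty$ as $n\to\infty$, and such that for all sufficiently large $n$ we have $$h(x_{q_n';R,NR})>L\,\frac{\rho(q_n')}{\log q_n'}\quad\text{and}\quad h(x_{q_n;NR,R})>L\,\frac{\rho(q_n)}{\log q_n}.$$
   Context: For an integer $q\ge 3$: $\rho(q)$ is the number of $x\in(\mathbf{Z}/q\mathbf{Z})^\times$ with $x^2=1$; $R_q=\{a^2: a\in(\mathbf{Z}/q\mathbf{Z})^\times\}$ and $NR_q=(\mathbf{Z}/q\mathbf{Z})^\times\setminus R_q$; $\pi(x;q,a)$ is the number of primes $p\le x$ with $p\equiv a \pmod q$. Define $$x_{q;R,NR}=\inf\Bigl\{x\ge 2:\ \frac{1}{|R_q|}\sum_{a\in R_q}\pi(x;q,a)>\frac{1}{|NR_q|}\sum_{b\in NR_q}\pi(x;q,b)\Bigr\},$$ and $x_{q;NR,R}$ as the infimum of the $x\ge2$ for which the reversed strict inequality ($<$) holds. When finite, these are integers (the counting functions only jump at primes); if the set is empty the infimum is $+\infty$, and $h(+\infty)=+\infty$ by convention. *)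

theory Defs
  imports "HOL-Number_Theory.Number_Theory" "HOL-Computational_Algebra.Squarefree"
    "HOL-Library.Extended_Real"
begin

(* For q >= 2, the unit group of Z/qZ is represented by the reduced residue system
   totatives q, a subset of {1..<q}. *)

definition rho :: "nat \<Rightarrow> nat" where
  "rho q = card {x \<in> totatives q. [x ^ 2 = 1] (mod q)}"

definition residues_sq :: "nat \<Rightarrow> nat set" where
  "residues_sq q = (\<lambda>a. a ^ 2 mod q) ` totatives q"

definition nonresidues_sq :: "nat \<Rightarrow> nat set" where
  "nonresidues_sq q = totatives q - residues_sq q"

definition prime_count :: "real \<Rightarrow> nat \<Rightarrow> nat \<Rightarrow> nat" where
  "prime_count x q a = card {p :: nat. prime p \<and> real p \<le> x \<and> [p = a] (mod q)}"

definition mean_prime_count :: "real \<Rightarrow> nat \<Rightarrow> nat set \<Rightarrow> real" where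
  "mean_prime_count x q A = 1 / real (card A) * (\<Sum>a\<in>A. real (prime_count x q a))"

(* The infimum over real x >= 2 is taken in the extended reals, so that Inf {} = \<infinity>. *)

definition first_lead :: "nat \<Rightarrow> nat set \<Rightarrow> nat set \<Rightarrow> ereal" where
  "first_lead q A B =
     Inf (ereal ` {x. 2 \<le> x \<and> mean_prime_count x q A > mean_prime_count x q B})"

definition x_R_NR :: "nat \<Rightarrow> ereal" where
  "x_R_NR q = first_lead q (residues_sq q) (nonresidues_sq q)"

definition x_NR_R :: "nat \<Rightarrow> ereal" where
  "x_NR_R q = first_lead q (nonresidues_sq q) (residues_sq q)"

(* Extension of h by h(\<infinity>) = \<infinity>. It is only applied to values of first_lead, which are
   natural numbers when finite (lemma first_lead_nat), so the floor is then exact. *)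

definition extend_infty :: "(nat \<Rightarrow> real) \<Rightarrow> ereal \<Rightarrow> ereal" where
  "extend_infty h X = (if X = \<infinity> then \<infinity> else ereal (h (nat \<lfloor>real_of_ereal X\<rfloor>)))"

lemma mean_prime_count_floor:
  assumes "0 \<le> x"
  shows "mean_prime_count x q A = mean_prime_count (real (nat \<lfloor>x\<rfloor>)) q A"
proof -
  have "real p \<le> x \<longleftrightarrow> real p \<le> real (nat \<lfloor>x\<rfloor>)" for p
    using assms le_nat_floor[of p x] of_nat_floor[of x] of_nat_le_iff[where ?'a = real] by (meson order_trans)
  then show ?thesis
    unfolding mean_prime_count_def prime_count_def by simp
qed

lemma first_lead_nat:
  assumes "first_lead q A B \<noteq> \<infinity>"
  shows "\<exists>n::nat. 2 \<le> n \<and> first_lead q A B = ereal (real n)"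
proof -
  define P where "P x \<longleftrightarrow> mean_prime_count x q A > mean_prime_count x q B" for x
  define S where "S = {x::real. 2 \<le> x \<and> P x}"
  have F: "first_lead q A B = Inf (ereal ` S)"
    by (simp add: first_lead_def S_def P_def)
  have P_floor: "P (real (nat \<lfloor>x\<rfloor>))" if "x \<in> S" for x
    using that mean_prime_count_floor[of x q] by (simp add: S_def P_def)
  have two: "2 \<le> nat \<lfloor>x\<rfloor>" if "x \<in> S" for x
    using that by (simp add: S_def le_nat_iff le_floor_iff)
  define n where "n = (LEAST n::nat. 2 \<le> n \<and> P (real n))"
  have "S \<noteq> {}"
    using assms F by (auto simp: top_ereal_def)
  then have n: "2 \<le> n \<and> P (real n)"
    unfolding n_def using P_floor two by (metis (mono_tags, lifting) LeastI ex_in_conv)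
  have "real n \<le> x" if "x \<in> S" for x
  proof -
    have "n \<le> nat \<lfloor>x\<rfloor>"
      unfolding n_def using P_floor[OF that] two[OF that] by (intro Least_le) simp
    then show ?thesis using n by linarith
  qed
  moreover have "real n \<in> S" using n by (simp add: S_def)
  ultimately have "Inf (ereal ` S) = ereal (real n)"
    by (intro antisym Inf_lower Inf_greatest) auto
  with n F show ?thesis by auto
qed

end

theory Submission
  imports Defs "HOL-Real_Asymp.Real_Asymp"
begin

text \<open>If every prime up to \<open>N\<close> divides \<open>q\<close>, no prime up to \<open>N\<close> is counted in any reduced residue
  class, so neither side leads before \<open>N\<close>. It remains to place \<open>rho q / ln q\<close> in a window
  \<open>[M, 2M)\<close> that is independent of \<open>N\<close>. A new odd prime factor doubles \<open>rho\<close>, so starting from the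
  primorial, one huge prime makes the ratio small; then many moderate primes, found as divisors of
  the pairwise coprime numbers \<open>1 + i * m! * 2q\<close>, make it grow beyond \<open>M\<close>. Taking \<open>N\<close> with
  \<open>h N > 2 L M\<close> and letting \<open>M\<close> tend to infinity, the same moduli serve as \<open>q\<^sub>n\<close> and \<open>q'\<^sub>n\<close>.\<close>

section \<open>Counting the square roots of 1 modulo \<open>q\<close>\<close>

lemma rho_pos:
  assumes "q \<ge> 1"
  shows "rho q > 0"
proof -
  have "1 \<in> {x \<in> totatives q. [x ^ 2 = 1] (mod q)}"
    using assms by (auto simp: in_totatives_iff)
  moreover have "finite {x \<in> totatives q. [x ^ 2 = 1] (mod q)}"
    by simp
  ultimately show ?thesis
    unfolding rho_def card_gt_0_iff by blast
qed

text \<open>The Chinese remainder bijection \<open>?f\<close> on totatives respects the equation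
  \<open>x ^ 2 = 1\<close>, so it restricts to a bijection between the solution sets.\<close>

lemma rho_mult_coprime:
  assumes "coprime m n" "m > 1" "n > 1"
  shows "rho (m * n) = rho m * rho n"
proof -
  let ?S = "\<lambda>q. {x \<in> totatives q. [x ^ 2 = 1] (mod q)}"
  let ?f = "\<lambda>x. (x mod m, x mod n)"
  have bij: "bij_betw ?f (totatives (m * n)) (totatives m \<times> totatives n)"
    using assms by (intro bij_betw_totatives) auto
  have iff: "[x ^ 2 = 1] (mod m * n) \<longleftrightarrow> [(x mod m) ^ 2 = 1] (mod m) \<and> [(x mod n) ^ 2 = 1] (mod n)" for x
  proof -
    have "[x ^ 2 = 1] (mod m * n) \<longleftrightarrow> [x ^ 2 = 1] (mod m) \<and> [x ^ 2 = 1] (mod n)"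
      using coprime_cong_mult_nat[OF _ _ assms(1)] cong_modulus_mult_nat cong_modulus_mult_nat[of _ _ n m]
      unfolding mult.commute[of n m] by blast
    then show ?thesis
      unfolding Cong.cong_def power_mod .
  qed
  have "?f ` ?S (m * n) = ?S m \<times> ?S n"
  proof (intro equalityI subsetI)
    fix y assume "y \<in> ?f ` ?S (m * n)"
    then obtain x where x: "x \<in> totatives (m * n)" "[x ^ 2 = 1] (mod m * n)" "y = ?f x" by blast
    then have "y \<in> totatives m \<times> totatives n"
      using bij_betwE[OF bij] by blast
    then show "y \<in> ?S m \<times> ?S n"
      using x iff[of x] by simp
  next
    fix y assume y: "y \<in> ?S m \<times> ?S n"
    then have "y \<in> ?f ` totatives (m * n)"
      using bij unfolding bij_betw_def by blast
    then obtain x where "x \<in> totatives (m * n)" "y = ?f x" by blast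
    then show "y \<in> ?f ` ?S (m * n)"
      using y iff[of x] by (intro image_eqI[of _ _ x]) auto
  qed
  moreover have "inj_on ?f (?S (m * n))"
    using bij by (auto simp: bij_betw_def intro: inj_on_subset)
  ultimately have "bij_betw ?f (?S (m * n)) (?S m \<times> ?S n)"
    by (intro bij_betw_imageI)
  then have "card (?S (m * n)) = card (?S m \<times> ?S n)"
    by (rule bij_betw_same_card)
  then show ?thesis
    by (simp add: rho_def card_cartesian_product)
qed

text \<open>Modulo a prime the only square roots of 1 are 1 and -1; among the totatives these are
  \<open>1\<close> and \<open>p - 1\<close>, which differ because \<open>p > 2\<close>.\<close>

lemma rho_odd_prime:
  assumes "prime p" "odd p"
  shows "rho p = 2"
proof -
  have p: "p > 2"
    using assms prime_gt_1_nat[of p] by (cases "p = 2") auto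
  have "{x \<in> totatives p. [x ^ 2 = 1] (mod p)} = {1, p - 1}"
  proof (intro equalityI subsetI)
    fix x assume x: "x \<in> {x \<in> totatives p. [x ^ 2 = 1] (mod p)}"
    then have "0 < x" "x < p"
      using p by (auto simp: in_totatives_iff intro: totatives_less)
    have "[int x * int x = 1] (mod int p)"
      using x by (metis (mono_tags, lifting) cong_int_iff mem_Collect_eq of_nat_1 of_nat_mult power2_eq_square)
    then have "[int x = 1] (mod int p) \<or> [int x = - 1] (mod int p)"
      using assms(1) \<open>0 < x\<close> by (intro cong_square) auto
    then have "int p dvd int x - 1 \<or> int p dvd int x + 1"
      by (auto simp: cong_iff_dvd_diff)
    then show "x \<in> {1, p - 1}"
      using \<open>0 < x\<close> \<open>x < p\<close> zdvd_imp_le[of "int p" "int x - 1"] zdvd_imp_le[of "int p" "int x + 1"]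
      by (cases "x = 1") auto
  next
    fix x assume x: "x \<in> {1, p - 1}"
    have "coprime (p - 1) p"
      using p coprime_diff_one_left_nat[of p] by simp
    moreover have "[(p - 1) ^ 2 = 1] (mod p)"
    proof -
      have "(p - 1) ^ 2 = 1 + p * (p - 2)"
        using p by (auto simp: power2_eq_square algebra_simps dest!: less_imp_Suc_add)
      then show ?thesis
        unfolding Cong.cong_def by (simp only: mod_mult_self2)
    qed
    ultimately show "x \<in> {x \<in> totatives p. [x ^ 2 = 1] (mod p)}"
      using x p by (auto simp: in_totatives_iff)
  qed
  then show ?thesis
    using p by (simp add: rho_def)
qed

lemma rho_mult_odd_prime:
  assumes "q > 1" "prime p" "odd p" "\<not> p dvd q"
  shows "rho (q * p) = 2 * rho q"
  using assms rho_mult_coprime[of q p] rho_odd_prime[of p] prime_gt_1_nat[of p]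
    prime_imp_coprime[of p q] by (simp add: coprime_commute)

section \<open>A supply of new prime factors of moderate size\<close>

lemma squarefree_mult_prime:
  fixes q p :: nat
  assumes "squarefree q" "prime p" "\<not> p dvd q"
  shows "squarefree (q * p)"
  using assms prime_imp_coprime[of p q]
  by (intro squarefree_mult_coprime) (auto simp: coprime_commute intro: squarefree_prime)

text \<open>These are the moduli of Goedel's beta function. A common prime factor divides
  \<open>(j - i) * d\<close>; since \<open>j - i \<le> m\<close> divides \<open>fact m\<close>, it
  divides \<open>d\<close> in either case, and hence 1.\<close>

lemma coprime_beta:
  fixes d i j m :: nat
  assumes "i < j" "j \<le> m" "fact m dvd d"
  shows "coprime (1 + i * d) (1 + j * d)"
proof (rule ccontr)
  assume "\<not> coprime (1 + i * d) (1 + j * d)"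
  then obtain p where p: "prime p" "p dvd 1 + i * d" "p dvd 1 + j * d"
    using prime_factor_nat[of "gcd (1 + i * d) (1 + j * d)"]
    by (auto simp only: coprime_iff_gcd_eq_1 gcd_greatest_iff)
  have "p dvd (1 + j * d) - (1 + i * d)"
    using p by (intro dvd_diff_nat)
  also have "(1 + j * d) - (1 + i * d) = (j - i) * d"
    by (simp add: diff_mult_distrib)
  finally have "p dvd j - i \<or> p dvd d"
    using p prime_dvd_mult_nat by blast
  moreover have "j - i dvd d"
    using assms dvd_fact[of "j - i" m] by (auto intro: dvd_trans)
  ultimately have "p dvd d"
    using dvd_trans by blast
  then have "p dvd 1"
    using p(2) by (metis dvd_add_left_iff dvd_mult)
  then show False
    using p(1) by auto
qed

text \<open>One prime factor is taken from each of \<open>m\<close> pairwise coprime numbers, so the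
  primes are distinct. The explicit bound matters later: it makes \<open>ln (f i)\<close> at most
  polynomial in \<open>m\<close>.\<close>

lemma small_primes_avoiding:
  fixes q m :: nat
  assumes "q > 0"
  shows "\<exists>f. inj_on f {..<m} \<and>
    (\<forall>i<m. prime (f i) \<and> odd (f i) \<and> \<not> f i dvd q \<and> f i \<le> 1 + m * (fact m * (2 * q)))"
proof -
  \<comment> \<open>The factor \<open>fact m\<close> gives pairwise coprimality; the factor
    \<open>2 * q\<close> forces the primes to be odd and prime to \<open>q\<close>.\<close>
  define d where "d = fact m * (2 * q)"
  have d: "d > 0" using assms by (simp add: d_def)
  \<comment> \<open>The index starts at 1, since \<open>1 + 0 * d\<close> has no prime
    factor.\<close>
  have "\<exists>p. prime p \<and> p dvd 1 + Suc i * d" for i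
    using d by (intro prime_factor_nat) auto
  then obtain f where f: "\<And>i. prime (f i)" "\<And>i. f i dvd 1 + Suc i * d"
    by metis
  have nd: "\<not> f i dvd d" for i
  proof
    assume "f i dvd d"
    then have "f i dvd 1"
      using f(2)[of i] by (metis dvd_add_left_iff dvd_mult)
    then show False using f(1)[of i] by auto
  qed
  have ne: "f i \<noteq> f j" if "i < j" "j < m" for i j
  proof
    assume "f i = f j"
    moreover have "coprime (1 + Suc i * d) (1 + Suc j * d)"
      using that by (intro coprime_beta[of _ _ m]) (auto simp: d_def)
    ultimately show False
      using f by (metis coprime_common_divisor not_prime_unit)
  qed
  have "inj_on f {..<m}"
    by (intro inj_onI) (metis lessThan_iff linorder_neqE_nat ne)
  moreover have "odd (f i)" "\<not> f i dvd q" for i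
    using nd[of i] f(1)[of i] primes_dvd_imp_eq[of 2 "f i"] by (auto simp: d_def)
  moreover have "f i \<le> 1 + m * d" if "i < m" for i
  proof -
    have "f i \<le> 1 + Suc i * d"
      using f(2) by (intro dvd_imp_le) auto
    also have "\<dots> \<le> 1 + m * d"
      using that by (intro add_left_mono mult_right_mono) auto
    finally show ?thesis .
  qed
  ultimately show ?thesis
    using f(1) unfolding d_def by blast
qed

section \<open>Steering the ratio by passing to multiples\<close>

lemma rho_ratio_small_multiple:
  assumes "q > 1" "squarefree q" "c > 0"
  shows "\<exists>q'. q dvd q' \<and> q' > 1 \<and> squarefree q' \<and> real (rho q') / ln (real q') < c"
proof -
  \<comment> \<open>Exceeding 2 and \<open>q\<close> makes \<open>p\<close> odd and no divisor of
    \<open>q\<close>, so \<open>rho (q * p) = 2 * rho q\<close>; the exponential makes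
    \<open>ln p\<close> alone large enough for the ratio to drop below \<open>c\<close>.\<close>
  obtain p where p: "prime p" "p > max (max 2 q) (nat \<lceil>exp (2 * real (rho q) / c)\<rceil>)"
    using bigger_prime by blast
  have "odd p" using p prime_odd_nat by auto
  have "\<not> p dvd q"
    using p assms by (auto dest: dvd_imp_le)
  have "exp (2 * real (rho q) / c) < real p"
    using p(2) by linarith
  then have "2 * real (rho q) / c < ln (real p)"
    using p(2) by (subst exp_less_cancel_iff [symmetric]) auto
  also have "\<dots> \<le> ln (real (q * p))"
    using p(2) assms by (subst ln_le_cancel_iff) auto
  finally have less: "2 * real (rho q) / c < ln (real (q * p))" .
  have gt1: "q * p > 1"
    using assms(1) prime_gt_1_nat[OF p(1)] by (simp add: one_less_mult)
  then have "ln (real (q * p)) > 0"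
    by (metis ln_gt_zero of_nat_1 of_nat_less_iff)
  then have "real (rho (q * p)) / ln (real (q * p)) < c"
    using less \<open>c > 0\<close> rho_mult_odd_prime[OF assms(1) p(1) \<open>odd p\<close> \<open>\<not> p dvd q\<close>]
    by (simp del: of_nat_mult add: pos_divide_less_eq mult.commute[of c])
  then show ?thesis
    using assms gt1 \<open>\<not> p dvd q\<close> p(1) squarefree_mult_prime by (intro exI[of _ "q * p"]) auto
qed

text \<open>Each new prime at most doubles the ratio, so on its way up it cannot jump over \<open>[M, 2M)\<close>.\<close>
lemma rho_ratio_between_multiple:
  assumes q: "q > 1" "squarefree q" and M: "M > 0" "real (rho q) / ln (real q) < M"
  shows "\<exists>q'. q dvd q' \<and> q' > 1 \<and> squarefree q' \<and>
    M \<le> real (rho q') / ln (real q') \<and> real (rho q') / ln (real q') < 2 * M"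
proof -
  define l where "l = ln (4 * real q)"
  define a where "a = ln (real q)"
  have "a > 0" "l > 0"
    using q(1) by (auto simp: a_def l_def intro!: ln_gt_zero)
  \<comment> \<open>\<open>K\<close> collects all constants: what remains is that a polynomial in
    \<open>m\<close> with fixed coefficients is eventually below \<open>2 ^ m / K\<close>.\<close>
  define K where "K = M * (a + l + 1)"
  have "K > 0"
    using \<open>a > 0\<close> \<open>l > 0\<close> M by (simp add: K_def)
  have "(\<lambda>m. (1 + real m * (1 + (real m + 1) * real m)) / 2 ^ m) \<longlonglongrightarrow> 0"
    by real_asymp
  then have "eventually (\<lambda>m. (1 + real m * (1 + (real m + 1) * real m)) / 2 ^ m < 1 / K) sequentially"
    using \<open>K > 0\<close> by (intro order_tendstoD(2)) auto
  then obtain m where m': "(1 + real m * (1 + (real m + 1) * real m)) / 2 ^ m < 1 / K" "m \<ge> 1"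
    using eventually_happens'[OF sequentially_bot eventually_conj[OF _ eventually_ge_at_top]] by blast
  have "a + real m * (l + (real m + 1) * real m)
      \<le> (a + l + 1) + real m * ((a + l + 1) + (a + l + 1) * ((real m + 1) * real m))"
    using \<open>a > 0\<close> \<open>l > 0\<close> mult_right_mono[of 1 "a + l + 1" "(real m + 1) * real m"]
    by (intro add_mono mult_left_mono) auto
  also have "\<dots> = (a + l + 1) * (1 + real m * (1 + (real m + 1) * real m))"
    by (simp add: algebra_simps)
  finally have "M * (a + real m * (l + (real m + 1) * real m)) \<le> K * (1 + real m * (1 + (real m + 1) * real m))"
    using M(1) unfolding K_def mult.assoc by (intro mult_left_mono) auto
  also have "\<dots> \<le> 2 ^ m"
    using m'(1) \<open>K > 0\<close> by (simp add: field_simps)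
  finally have m: "M * (a + real m * (l + (real m + 1) * real m)) \<le> 2 ^ m" "m \<ge> 1"
    using m' by auto
  obtain f where f: "inj_on f {..<m}"
    and pf: "\<And>i. i < m \<Longrightarrow> prime (f i)" "\<And>i. i < m \<Longrightarrow> odd (f i)" "\<And>i. i < m \<Longrightarrow> \<not> f i dvd q"
    and bound: "\<And>i. i < m \<Longrightarrow> f i \<le> 1 + m * (fact m * (2 * q))"
    using small_primes_avoiding[of q m] q(1) by auto
  \<comment> \<open>The new primes are adjoined one at a time, and \<open>r\<close> follows the
    ratio along the way.\<close>
  define Q where "Q j = q * (\<Prod>i<j. f i)" for j
  define r where "r j = real (rho (Q j)) / ln (real (Q j))" for j
  have Q_Suc: "Q (Suc j) = Q j * f j" for j
    by (simp add: Q_def)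
  have nd: "\<not> f j dvd Q j" if j: "j < m" for j
  proof
    assume "f j dvd Q j"
    then have "f j dvd (\<Prod>i<j. f i)"
      using pf[OF j] prime_dvd_mult_nat unfolding Q_def by blast
    then obtain i where i: "i < j" "f j dvd f i"
      using pf(1)[OF j] by (auto simp: prime_dvd_prod_iff)
    then have "f j = f i"
      using pf(1) j by (simp add: primes_dvd_imp_eq)
    then show False
      using f i j by (auto dest: inj_onD)
  qed
  have Q: "Q j > 1 \<and> squarefree (Q j) \<and> rho (Q j) = 2 ^ j * rho q" if "j \<le> m" for j
    using that
  proof (induction j)
    case 0
    then show ?case using q by (simp add: Q_def)
  next
    case (Suc j)
    then show ?case
      using pf[of j] nd[of j] prime_gt_1_nat[of "f j"]
      by (auto simp: Q_Suc rho_mult_odd_prime squarefree_mult_prime one_less_mult)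
  qed
  \<comment> \<open>By \<open>fact m \<le> m ^ m\<close>, the bound on \<open>f i\<close> is at most
    \<open>4 * q * m ^ (m + 1)\<close>; then \<open>ln m \<le> m\<close> is applied. The condition
    \<open>m \<ge> 1\<close> absorbs the summand 1 and makes \<open>ln m\<close> meaningful.\<close>
  have ln_f: "ln (real (f i)) \<le> l + (real m + 1) * real m" if "i < m" for i
  proof -
    have "real (f i) \<le> real (1 + m * (fact m * (2 * q)))"
      using bound[OF that] by (simp only: of_nat_le_iff)
    also have "\<dots> \<le> real (4 * q * (m * m ^ m))"
    proof -
      have "fact m \<le> m ^ m"
        using fact_le_power[of m, where ?'a = nat] by simp
      then have "m * (fact m * (2 * q)) \<le> m * (m ^ m * (2 * q))"
        by (intro mult_le_mono le_refl)
      moreover have "0 < q * (m * m ^ m)"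
        using q(1) m(2) by simp
      moreover have "m * (m ^ m * (2 * q)) = 2 * (q * (m * m ^ m))"
        by (simp only: ac_simps)
      ultimately have "1 + m * (fact m * (2 * q)) \<le> 4 * (q * (m * m ^ m))"
        by linarith
      then show ?thesis
        by (simp only: of_nat_le_iff mult.assoc)
    qed
    also have "\<dots> = 4 * real q * real m ^ (m + 1)"
      by simp
    finally have "ln (real (f i)) \<le> ln (4 * real q * real m ^ (m + 1))"
      using pf(1)[OF that] prime_gt_0_nat q m by (subst ln_le_cancel_iff) auto
    also have "\<dots> = l + (real m + 1) * ln (real m)"
      using q m by (simp add: ln_mult ln_realpow l_def algebra_simps)
    also have "\<dots> \<le> l + (real m + 1) * real m"
      using ln_bound[of "real m"] m by (intro add_left_mono mult_left_mono) auto
    finally show ?thesis .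
  qed
  have ln_Q: "ln (real (Q j)) \<le> a + real j * (l + (real m + 1) * real m)" if "j \<le> m" for j
    using that
  proof (induction j)
    case 0
    then show ?case by (simp add: Q_def a_def)
  next
    case (Suc j)
    have "ln (real (Q (Suc j))) = ln (real (Q j)) + ln (real (f j))"
      using Suc.prems Q[of j] pf(1)[of j] prime_gt_0_nat[of "f j"] by (simp add: Q_Suc ln_mult)
    then show ?case
      using Suc ln_f[of j] by (simp add: algebra_simps)
  qed
  have ln_pos: "ln (real (Q j)) > 0" if "j \<le> m" for j
    using Q[OF that] by simp
  \<comment> \<open>The logarithm of \<open>Q m\<close> is polynomial in \<open>m\<close>, whereas
    \<open>rho (Q m)\<close> is at least \<open>2 ^ m\<close>; the choice of \<open>m\<close> thus
    lifts the ratio to \<open>M\<close> by the last step.\<close>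
  have "M * ln (real (Q m)) \<le> 2 ^ m"
    using ln_Q[of m] m(1) M(1) by (meson mult_left_mono less_imp_le order_refl order_trans)
  also have "\<dots> \<le> real (rho (Q m))"
    using Q[of m] rho_pos[of q] q by simp
  finally have "M \<le> r m"
    using ln_pos[of m] by (simp add: r_def pos_le_divide_eq)
  moreover have "\<not> M \<le> r 0"
    using M by (simp add: r_def Q_def)
  ultimately obtain k where k: "k < m" "\<not> M \<le> r k" "M \<le> r (Suc k)"
    using ex_least_nat_less[of "\<lambda>j. M \<le> r j"] by blast
  have "r (Suc k) \<le> 2 * r k"
  proof -
    have "r (Suc k) = 2 * real (rho (Q k)) / ln (real (Q (Suc k)))"
      using k(1) Q[of k] Q[of "Suc k"] by (simp add: r_def)
    also have "\<dots> \<le> 2 * real (rho (Q k)) / ln (real (Q k))"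
    proof (intro divide_left_mono mult_pos_pos)
      have "Q k \<le> Q (Suc k)"
        using k(1) pf(1)[of k] prime_ge_1_nat by (simp add: Q_Suc)
      then show "ln (real (Q k)) \<le> ln (real (Q (Suc k)))"
        using k(1) Q[of k] by (subst ln_le_cancel_iff) auto
    qed (use k(1) ln_pos in auto)
    finally show ?thesis by (simp add: r_def)
  qed
  with k Q[of "Suc k"] show ?thesis
    by (intro exI[of _ "Q (Suc k)"]) (auto simp: r_def Q_def)
qed

section \<open>Moduli divisible by all small primes\<close>

lemma squarefree_primorial: "squarefree (\<Prod>{p. prime p \<and> p \<le> (N::nat)})"
  by (intro squarefree_prod_coprime) (auto intro: squarefree_prime primes_coprime)

text \<open>Lowering and then raising the ratio both pass to multiples, so divisibility by the
  primes up to \<open>N\<close> survives. The window depends on \<open>M\<close> alone, which leaves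
  \<open>N\<close> free to be chosen after \<open>M\<close>.\<close>

lemma exists_modulus:
  fixes M :: real and N :: nat
  assumes "M > 0"
  shows "\<exists>q. q \<ge> 3 \<and> squarefree q \<and> (\<forall>p. prime p \<and> p \<le> N \<longrightarrow> p dvd q) \<and>
    M \<le> real (rho q) / ln (real q) \<and> real (rho q) / ln (real q) < 2 * M"
proof -
  \<comment> \<open>The prime 3 is included so that \<open>q0 \<ge> 3\<close> even for small
    \<open>N\<close>.\<close>
  define K where "K = max N 3"
  define q0 where "q0 = \<Prod>{p. prime p \<and> p \<le> K}"
  have fin: "finite {p. prime p \<and> p \<le> K}"
    by (rule finite_subset[of _ "{..K}"]) auto
  have dvd: "p dvd q0" if "prime p" "p \<le> K" for p
    using dvd_prodI[OF fin, of p "\<lambda>x. x"] that by (simp add: q0_def)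
  have pos: "q0 > 0"
    unfolding q0_def by (intro prod_pos) (auto intro: prime_gt_0_nat)
  then have "q0 \<ge> 3"
    using dvd[of 3] by (intro dvd_imp_le) (auto simp: K_def)
  then obtain q1 where q1: "q0 dvd q1" "q1 > 1" "squarefree q1" "real (rho q1) / ln (real q1) < M"
    using rho_ratio_small_multiple[of q0 M] squarefree_primorial[of K] assms by (auto simp: q0_def)
  obtain q where q: "q1 dvd q" "q > 1" "squarefree q"
    "M \<le> real (rho q) / ln (real q)" "real (rho q) / ln (real q) < 2 * M"
    using rho_ratio_between_multiple[OF q1(2,3) assms q1(4)] by blast
  have "q0 dvd q" using q1 q dvd_trans by blast
  then have "q \<ge> 3"
    using \<open>q0 \<ge> 3\<close> q(2) dvd_imp_le[of q0 q] by simp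
  moreover have "p dvd q" if "prime p" "p \<le> N" for p
    using dvd[of p] that \<open>q0 dvd q\<close> dvd_trans by (auto simp: K_def)
  ultimately show ?thesis using q by blast
qed

section \<open>Lower bounds for the first lead, and the conclusion\<close>

lemma first_lead_ge:
  assumes dvd: "\<And>p. prime p \<Longrightarrow> p \<le> N \<Longrightarrow> p dvd q"
    and "\<And>a. a \<in> A \<Longrightarrow> coprime a q" "\<And>b. b \<in> B \<Longrightarrow> coprime b q"
  shows "first_lead q A B \<ge> ereal (real N)"
proof -
  have count: "prime_count x q a = 0" if "x < real N" "coprime a q" for x a
  proof -
    \<comment> \<open>A prime congruent to a unit modulo \<open>q\<close> is itself prime to
      \<open>q\<close>, yet every prime up to \<open>N\<close> divides \<open>q\<close>.\<close>
    have False if "prime p" "real p \<le> x" "[p = a] (mod q)" for p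
    proof -
      have "p dvd q"
        using dvd that \<open>x < real N\<close> by simp
      moreover have "coprime p q"
        using that(3) \<open>coprime a q\<close> cong_imp_coprime cong_sym by blast
      ultimately show False
        using that(1) by (metis coprime_absorb_left not_prime_unit)
    qed
    then show ?thesis
      unfolding prime_count_def by (metis (mono_tags, lifting) Collect_empty_eq card.empty)
  qed
  have "mean_prime_count x q A = 0" "mean_prime_count x q B = 0" if "x < real N" for x
    using assms(2,3) count[OF that] by (simp_all add: mean_prime_count_def)
  then show ?thesis
    unfolding first_lead_def by (intro Inf_greatest) (force simp: not_le[symmetric])
qed

lemma coprime_residues_sq: "a \<in> residues_sq q \<Longrightarrow> coprime a q"
  by (auto simp: residues_sq_def in_totatives_iff coprime_mod_left_iff)

lemma coprime_nonresidues_sq: "a \<in> nonresidues_sq q \<Longrightarrow> coprime a q"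
  by (auto simp: nonresidues_sq_def in_totatives_iff)

text \<open>As \<open>N\<close> is an integer, rounding \<open>X\<close> down keeps it at least
  \<open>N\<close>; an infinite \<open>X\<close> is covered by the convention for
  \<open>h\<close>.\<close>

lemma extend_infty_ge:
  assumes "mono h" "X \<ge> ereal (real N)"
  shows "extend_infty h X \<ge> ereal (h N)"
proof (cases X)
  case (real x)
  then have "N \<le> nat \<lfloor>x\<rfloor>"
    using assms(2) by (simp add: le_nat_floor)
  then show ?thesis
    using real assms(1) by (simp add: extend_infty_def monoD)
qed (use assms in \<open>auto simp: extend_infty_def\<close>)

theorem theorem1p3:
  fixes h :: "nat \<Rightarrow> real" and L :: real
  assumes h_pos: "\<And>n. h n > 0"
    and h_mono: "mono h"
    and h_lim: "filterlim h at_top sequentially"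
    and L_pos: "L > 0"
  shows "\<exists>(q :: nat \<Rightarrow> nat) (q' :: nat \<Rightarrow> nat).
    (\<forall>n. 3 \<le> q n \<and> squarefree (q n)) \<and>
    (\<forall>n. 3 \<le> q' n \<and> squarefree (q' n)) \<and>
    filterlim (\<lambda>n. real (rho (q n)) / ln (real (q n))) at_top sequentially \<and>
    filterlim (\<lambda>n. real (rho (q' n)) / ln (real (q' n))) at_top sequentially \<and>
    (\<forall>\<^sub>F n in sequentially.
       extend_infty h (x_R_NR (q' n)) > ereal (L * (real (rho (q' n)) / ln (real (q' n)))) \<and>
       extend_infty h (x_NR_R (q n)) > ereal (L * (real (rho (q n)) / ln (real (q n)))))"
proof -
  \<comment> \<open>The successor keeps \<open>M 0\<close> positive, as the construction of the
    modulus requires.\<close>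
  define M where "M n = real (Suc n)" for n
  \<comment> \<open>The value \<open>2 * M n\<close> is the upper end of the window, so
    \<open>h (N n)\<close> exceeds \<open>L\<close> times any ratio inside it.\<close>
  have "\<exists>N. h N > L * (2 * M n)" for n
    using h_lim eventually_happens'[OF sequentially_bot] unfolding filterlim_at_top_dense by blast
  then obtain N where N: "\<And>n. h (N n) > L * (2 * M n)"
    by metis
  have "\<forall>n. \<exists>q. q \<ge> 3 \<and> squarefree q \<and> (\<forall>p. prime p \<and> p \<le> N n \<longrightarrow> p dvd q) \<and>
      M n \<le> real (rho q) / ln (real q) \<and> real (rho q) / ln (real q) < 2 * M n"
    by (intro allI exists_modulus) (simp add: M_def)
  then obtain q where q: "\<And>n. q n \<ge> 3" "\<And>n. squarefree (q n)"
    "\<And>n p. prime p \<Longrightarrow> p \<le> N n \<Longrightarrow> p dvd q n"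
    "\<And>n. M n \<le> real (rho (q n)) / ln (real (q n))"
    "\<And>n. real (rho (q n)) / ln (real (q n)) < 2 * M n"
    by metis
  have "filterlim M at_top sequentially"
    unfolding M_def by real_asymp
  then have lim: "filterlim (\<lambda>n. real (rho (q n)) / ln (real (q n))) at_top sequentially"
    by (rule filterlim_at_top_mono) (simp add: q(4))
  have lead: "extend_infty h X > ereal (L * (real (rho (q n)) / ln (real (q n))))"
    if "X \<ge> ereal (real (N n))" for X n
  proof -
    have "L * (real (rho (q n)) / ln (real (q n))) < L * (2 * M n)"
      using q(5) L_pos by (intro mult_strict_left_mono)
    also note N
    finally show ?thesis
      using extend_infty_ge[OF h_mono that] by (meson ereal_less(2) less_ereal.simps(1) less_le_trans)
  qed
  have "x_R_NR (q n) \<ge> ereal (real (N n))" "x_NR_R (q n) \<ge> ereal (real (N n))" for n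
    unfolding x_R_NR_def x_NR_R_def
    by (intro first_lead_ge q(3) coprime_residues_sq coprime_nonresidues_sq; assumption)+
  then show ?thesis
    using q(1,2) lim lead by (intro exI[of _ q]) auto
qed

end
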